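(* Let $q$ be a prime power and let $\mathcal{P}$ be a subspace partition of $V(n,q)$ of type $[d_1^{n_{d_1}},\ldots,d_m^{n_{d_m}}]$ with $d_1<d_2<\cdots<d_m$. Let $2\le s\le m$, and let $ST$ be the $d_s$-supertail of $\mathcal{P}$. Suppose that $|ST|=\sigma_q(d_s,d_{s-1})$ and $d_s<2d_{s-1}$. Furthermore, assume that at least one of the following holds: (i) $s-1\le 2$, i.e. $ST$ contains subspaces of at most $2$ different dimensions; (ii) $d_s=2d_{s-1}-1$; (iii) all subspaces in $\mathcal{P}\setminus ST$ have the same dimension. Then the union of the subspaces in $ST$ is a subspace $W$ of $V(n,q)$. Moreover, either (a) $s-1=1$, $n_{d_1}=q^{d_1}+1$, and $\dim W=2d_1$; or (b) $s-1=2$, $n_{d_1}=q^{d_2}$, $n_{d_2}=1$, and $\dim W=d_1+d_2$.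
   Context: $V(n,q)$ denotes the $n$-dimensional vector space over the finite field with $q$ elements. A subspace partition of $V$ is a collection of nontrivial subspaces of $V$ such that every nonzero vector of $V$ lies in exactly one of them. If the distinct dimensions occurring in $\mathcal{P}$ are $d_1<\cdots<d_m$ and $n_d$ denotes the number of $d$-dimensional subspaces in $\mathcal{P}$, the type of $\mathcal{P}$ is $[d_1^{n_{d_1}},\ldots,d_m^{n_{d_m}}]$. For an integer $d$ with $d_1<d\le d_m$, the $d$-supertail of $\mathcal{P}$ is the set of subspaces in $\mathcal{P}$ of dimension less than $d$. For $1\le t<n$, $\sigma_q(n,t)$ denotes the minimum number of subspaces in a subspace partition of $V(n,q)$ whose largest subspace has dimension $t$. *)

theory Defs
  imports Complex_Main "HOL-Library.Function_Algebras" "HOL-Library.Cardinality"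
begin

text \<open>
  The space \<open>V(n,q)\<close> is realised as the coordinate space of all sequences over a finite field
  \<open>'a\<close> with \<open>q = CARD('a)\<close> elements that vanish from index \<open>n\<close> on. Spaces of all dimensions thus
  live in one type, which is needed because \<open>\<sigma>\<^sub>q(d\<^sub>s, d\<^sub>s\<^sub>-\<^sub>1)\<close> refers to a space whose
  dimension depends on the partition.
\<close>

definition cscale :: "'a::field \<Rightarrow> (nat \<Rightarrow> 'a) \<Rightarrow> (nat \<Rightarrow> 'a)" where
  "cscale c v = (\<lambda>i. c * v i)"

global_interpretation coord: vector_space "cscale :: 'a::field \<Rightarrow> (nat \<Rightarrow> 'a) \<Rightarrow> (nat \<Rightarrow> 'a)"
  by unfold_locales (auto simp: cscale_def fun_eq_iff algebra_simps)

definition coord_space :: "nat \<Rightarrow> (nat \<Rightarrow> 'a::field) set" where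
  "coord_space n = {v. \<forall>i\<ge>n. v i = 0}"

lemma subspace_coord_space: "coord.subspace (coord_space n)"
  by (auto simp: coord.subspace_def coord_space_def cscale_def)

lemma dim_coord_space: "coord.dim (coord_space n :: (nat \<Rightarrow> 'a::field) set) = n"
proof -
  define e where "e = (\<lambda>j i::nat. if i = j then 1 else 0 :: 'a)"
  have inj: "inj e"
    by (auto simp: inj_def e_def fun_eq_iff split: if_splits)
  have sum_e: "(\<Sum>j\<in>J. cscale (u j) (e j)) = (\<lambda>i. if i \<in> J then u i else 0)" if "finite J" for J u
    using that
  proof (induction J rule: finite_induct)
    case (insert j J)
    then show ?case by (auto simp: fun_eq_iff cscale_def e_def)
  qed (auto simp: fun_eq_iff)
  let ?B = "e ` {..<n}"
  have "coord.independent ?B"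
  proof (rule coord.independent_if_scalars_zero)
    fix f x assume *: "(\<Sum>x\<in>?B. cscale (f x) x) = 0" and "x \<in> ?B"
    then obtain j where j: "x = e j" "j < n" by auto
    have "(\<Sum>x\<in>?B. cscale (f x) x) = (\<Sum>j<n. cscale (f (e j)) (e j))"
      using inj by (subst sum.reindex) (auto intro: inj_on_subset)
    with * sum_e[of "{..<n}" "\<lambda>j. f (e j)"]
    have "(\<lambda>i. if i \<in> {..<n} then f (e i) else 0) = 0" by simp
    from fun_cong[OF this, of j] j show "f x = 0" by simp
  qed simp
  moreover have "?B \<subseteq> coord_space n"
    by (auto simp: coord_space_def e_def)
  moreover have "coord_space n \<subseteq> coord.span ?B"
  proof
    fix v :: "nat \<Rightarrow> 'a" assume "v \<in> coord_space n"
    then have "v = (\<Sum>j<n. cscale (v j) (e j))"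
      by (subst sum_e) (auto simp: fun_eq_iff coord_space_def)
    also have "\<dots> \<in> coord.span ?B"
      by (intro coord.span_sum coord.span_scale coord.span_base) auto
    finally show "v \<in> coord.span ?B" .
  qed
  ultimately have "coord.dim (coord_space n :: (nat \<Rightarrow> 'a) set) = card ?B"
    by (metis coord.basis_card_eq_dim)
  also have "\<dots> = n"
    using inj by (subst card_image) (auto intro: inj_on_subset)
  finally show ?thesis .
qed

definition subspace_partition :: "(nat \<Rightarrow> 'a::field) set \<Rightarrow> (nat \<Rightarrow> 'a) set set \<Rightarrow> bool" where
  "subspace_partition V P \<longleftrightarrow>
     (\<forall>U\<in>P. coord.subspace U \<and> U \<subseteq> V \<and> U \<noteq> {0}) \<and>
     (\<forall>v\<in>V. v \<noteq> 0 \<longrightarrow> (\<exists>!U. U \<in> P \<and> v \<in> U))"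

text \<open>
  The partition \<open>P\<close> is of type \<open>[d\<^sub>1\<^bsup>N d\<^sub>1\<^esup>, \<dots>, d\<^sub>m\<^bsup>N d\<^sub>m\<^esup>]\<close>; the multiplicity function \<open>N\<close> is
  indexed by dimensions, the sequence \<open>d\<close> by \<open>1, \<dots>, m\<close>.
\<close>

definition has_type ::
  "(nat \<Rightarrow> 'a::field) set set \<Rightarrow> nat \<Rightarrow> (nat \<Rightarrow> nat) \<Rightarrow> (nat \<Rightarrow> nat) \<Rightarrow> bool" where
  "has_type P m d N \<longleftrightarrow>
     strict_mono_on {1..m} d \<and>
     coord.dim ` P = d ` {1..m} \<and>
     (\<forall>i\<in>{1..m}. N (d i) = card {U \<in> P. coord.dim U = d i})"

definition supertail :: "(nat \<Rightarrow> 'a::field) set set \<Rightarrow> nat \<Rightarrow> (nat \<Rightarrow> 'a) set set" where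
  "supertail P k = {U \<in> P. coord.dim U < k}"

text \<open>
  The minimum is taken over partitions of the space over the given field \<open>'a\<close>; as finite fields
  of equal order are isomorphic, it depends on \<open>CARD('a)\<close> only.
\<close>

definition sigma :: "'a::{field,finite} itself \<Rightarrow> nat \<Rightarrow> nat \<Rightarrow> nat" where
  "sigma _ n t = (LEAST k. \<exists>P :: (nat \<Rightarrow> 'a) set set.
     subspace_partition (coord_space n) P \<and> Max (coord.dim ` P) = t \<and> card P = k)"

end

theory Submission
  imports Defs "HOL-Algebra.Algebraic_Closure_Type"
begin

text \<open>
  Write \<open>t = d (s - 1)\<close> and \<open>e = d s\<close>. A spread over the field of order \<open>q^t\<close> shows
  \<open>\<sigma>_q(e, t) \<le> q^t + 1\<close>. For a hyperplane \<open>H\<close> let \<open>S_H\<close> be the sum of \<open>|U|\<close> over the \<open>U \<in> ST\<close> contained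
  in \<open>H\<close>. Counting the points of \<open>H\<close> along the partition shows that \<open>S_H\<close> modulo \<open>q^e\<close> does not depend
  on \<open>H\<close>. Averaging \<open>S_H\<close> over all hyperplanes, and over those containing a fixed \<open>U\<^sub>0 \<in> ST\<close> of dimension
  \<open>t\<close>, forces \<open>|ST| = q^t + 1\<close> and \<open>S_H = q^t + k_H q^e\<close> with \<open>k_H \<ge> 0\<close>.

  The members of \<open>ST\<close> meet trivially in pairs, so the first two moments of \<open>S_H\<close> depend only on \<open>|ST|\<close>
  and the sum of the \<open>|U|\<close>. They give \<open>\<Sum> k_H (K - k_H) = 0\<close>, where \<open>K\<close> is the value of \<open>k_H\<close> for the
  whole space. As \<open>0 \<le> k_H \<le> K\<close>, each hyperplane either contains all of \<open>ST\<close> or has \<open>S_H = q^t\<close>.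
  Counting the former shows that the union of \<open>ST\<close> is as large as its span. A hyperplane with
  \<open>S_H = q^t\<close> containing \<open>U\<^sub>0\<close> contains no other member of \<open>ST\<close>, so \<open>W\<close> is the direct sum of \<open>U\<^sub>0\<close> and
  any other member of \<open>ST\<close>.
\<close>

subsection \<open>Annihilators in coordinate spaces\<close>

text \<open>The scalar multiplication is a parameter because the count serves two spaces: coordinate
  spaces and an extension field inside the algebraic closure. A new basis vector \<open>b\<close>
  brings a unique coefficient, hence a factor \<open>q\<close>.\<close>

lemma card_span_independent:
  fixes scale :: "'a::{field,finite} \<Rightarrow> 'b::ab_group_add \<Rightarrow> 'b"
  assumes "vector_space scale" and "finite B" and "\<not> module.dependent scale B"
  shows "card (module.span scale B) = CARD('a) ^ card B"
proof -
  interpret vector_space scale by fact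
  show ?thesis
    using assms(2,3)
  proof (induction B rule: finite_induct)
    case (insert b B)
    have ind: "independent B" and b: "b \<notin> span B"
      using insert by (auto simp: independent_insert)
    have "bij_betw (\<lambda>(c, x). scale c b + x) (UNIV \<times> span B) (span (insert b B))"
      unfolding bij_betw_def
    proof
      show "inj_on (\<lambda>(c, x). scale c b + x) (UNIV \<times> span B)"
      proof (rule inj_onI, clarify)
        fix c x c' x'
        assume x: "x \<in> span B" "x' \<in> span B" and eq: "scale c b + x = scale c' b + x'"
        have "scale (c - c') b = x' - x"
          using eq by (simp add: scale_left_diff_distrib algebra_simps)
        then have "scale (c - c') b \<in> span B" using x by (simp add: span_diff)
        then have "scale (inverse (c - c')) (scale (c - c') b) \<in> span B" by (rule span_scale)
        then have "c = c'" using b by (cases "c = c'") auto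
        then show "c = c' \<and> x = x'" using eq by simp
      qed
      show "(\<lambda>(c, x). scale c b + x) ` (UNIV \<times> span B) = span (insert b B)"
      proof (intro equalityI subsetI)
        fix v assume "v \<in> span (insert b B)"
        then obtain c where "v - scale c b \<in> span B" by (auto simp: span_insert)
        then show "v \<in> (\<lambda>(c, x). scale c b + x) ` (UNIV \<times> span B)"
          by (intro image_eqI[of _ _ "(c, v - scale c b)"]) auto
      qed (auto intro!: span_add intro: span_scale span_base span_mono[THEN subsetD, of B])
    qed
    from bij_betw_same_card[OF this] show ?case
      using insert ind by (simp add: card_cartesian_product)
  qed simp
qed

lemma finite_coord_space: "finite (coord_space n :: (nat \<Rightarrow> 'a::{field,finite}) set)"
proof (rule finite_subset)
  show "coord_space n \<subseteq> (\<lambda>f i. if i < n then f i else 0) ` ({..<n} \<rightarrow>\<^sub>E (UNIV :: 'a set))"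
  proof
    fix v :: "nat \<Rightarrow> 'a" assume "v \<in> coord_space n"
    then show "v \<in> (\<lambda>f i. if i < n then f i else 0) ` ({..<n} \<rightarrow>\<^sub>E UNIV)"
      by (intro image_eqI[of _ _ "restrict v {..<n}"]) (auto simp: coord_space_def fun_eq_iff)
  qed
qed (simp add: finite_PiE)

lemma card_subspace:
  fixes U :: "(nat \<Rightarrow> 'a::{field,finite}) set"
  assumes "coord.subspace U" "finite U"
  shows "card U = CARD('a) ^ coord.dim U"
proof -
  obtain B where B: "B \<subseteq> U" "coord.independent B" "U \<subseteq> coord.span B" "card B = coord.dim U"
    using coord.basis_exists by blast
  have "coord.span B = U"
    using B assms coord.span_subspace by blast
  moreover have "finite B" using B assms finite_subset by blast
  ultimately show ?thesis
    using card_span_independent[OF coord.vector_space_axioms, of B] B by simp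
qed

lemma card_coord_space: "card (coord_space n :: (nat \<Rightarrow> 'a::{field,finite}) set) = CARD('a) ^ n"
  using card_subspace[OF subspace_coord_space finite_coord_space] by (simp add: dim_coord_space)

lemma two_le_card_field: "2 \<le> CARD('a::{field,finite})"
  using card_mono[of UNIV "{0, 1 :: 'a}"] by simp

text \<open>Every \<open>x\<close> in \<open>A\<close> is uniquely a multiple of \<open>a\<close>
  plus a kernel element, the coefficient being \<open>f x / f a\<close>. Serves both for adding one
  vector to an annihilated set and for intersecting a subspace with a hyperplane.\<close>

lemma card_subspace_eq_card_kernel:
  fixes A :: "(nat \<Rightarrow> 'a::{field,finite}) set" and f :: "(nat \<Rightarrow> 'a) \<Rightarrow> 'a"
  assumes A: "coord.subspace A"
    and add: "\<And>x y. f (x + y) = f x + f y" and scale: "\<And>c x. f (cscale c x) = c * f x"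
    and a: "a \<in> A" "f a \<noteq> 0"
  shows "card A = CARD('a) * card {x \<in> A. f x = 0}"
proof -
  have diff: "f (x - y) = f x - f y" for x y
    using add[of "x - y" y] by (simp add: algebra_simps)
  have "bij_betw (\<lambda>(c, x). cscale c a + x) (UNIV \<times> {x \<in> A. f x = 0}) A"
    by (rule bij_betw_byWitness[where f' = "\<lambda>x. (f x / f a, x - cscale (f x / f a) a)"])
       (use a A in \<open>auto simp: add scale diff coord.subspace_add coord.subspace_scale
          coord.subspace_diff\<close>)
  from bij_betw_same_card[OF this] show ?thesis by (simp add: card_cartesian_product)
qed

definition dot :: "nat \<Rightarrow> (nat \<Rightarrow> 'a::field) \<Rightarrow> (nat \<Rightarrow> 'a) \<Rightarrow> 'a" where
  "dot n y v = (\<Sum>i<n. y i * v i)"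

lemma dot_add_left: "dot n (x + y) v = dot n x v + dot n y v"
  and dot_add_right: "dot n v (x + y) = dot n v x + dot n v y"
  and dot_cscale_left: "dot n (cscale c x) v = c * dot n x v"
  and dot_cscale_right: "dot n v (cscale c x) = c * dot n v x"
  by (simp_all add: dot_def cscale_def algebra_simps sum.distrib sum_distrib_left)

lemma dot_zero [simp]: "dot n 0 v = 0" "dot n v 0 = 0"
  by (simp_all add: dot_def)

lemma subspace_dot_right: "coord.subspace {v. dot n y v = 0}"
  by (simp add: coord.subspace_def dot_add_right dot_cscale_right)

lemma subspace_dot_left: "coord.subspace {y. dot n y v = 0}"
  by (simp add: coord.subspace_def dot_add_left dot_cscale_left)

lemma dot_nondegenerate:
  assumes "y \<in> coord_space n" "y \<noteq> 0"
  obtains v where "v \<in> coord_space n" "dot n y v \<noteq> 0"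
proof -
  obtain i where i: "y i \<noteq> 0" using assms by (auto simp: fun_eq_iff)
  then have "i < n" using assms by (auto simp: coord_space_def not_less[symmetric])
  define v where "v = (\<lambda>j. if j = i then 1 else 0 :: 'a)"
  have "dot n y v = (\<Sum>j<n. if j = i then y j else 0)"
    unfolding dot_def v_def by (intro sum.cong) auto
  also have "\<dots> = y i" using \<open>i < n\<close> by simp
  finally show ?thesis using that[of v] i \<open>i < n\<close> by (auto simp: v_def coord_space_def)
qed

text \<open>For nonzero \<open>y\<close>, membership says that the hyperplane orthogonal to
  \<open>y\<close> contains \<open>U\<close>. Elements are confined to \<open>coord_space n\<close>
  because \<open>dot n\<close> ignores all later coordinates.\<close>

definition annihilator :: "nat \<Rightarrow> (nat \<Rightarrow> 'a::field) set \<Rightarrow> (nat \<Rightarrow> 'a) set" where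
  "annihilator n U = {y \<in> coord_space n. \<forall>v\<in>U. dot n y v = 0}"

lemma annihilator_subset: "annihilator n U \<subseteq> coord_space n"
  by (auto simp: annihilator_def)

lemma finite_annihilator [simp]:
  "finite (annihilator n U :: (nat \<Rightarrow> 'a::{field,finite}) set)"
  using annihilator_subset finite_coord_space finite_subset by blast

lemma zero_in_coord_space [simp]: "0 \<in> coord_space n"
  by (simp add: coord_space_def)

lemma zero_in_annihilator [simp]: "0 \<in> annihilator n U"
  by (simp add: annihilator_def)

lemma annihilator_empty [simp]: "annihilator n {} = coord_space n"
  by (simp add: annihilator_def)

lemma annihilator_Union: "annihilator n (\<Union>A) = {y \<in> coord_space n. \<forall>U\<in>A. y \<in> annihilator n U}"
  by (auto simp: annihilator_def)

lemma annihilator_Un: "annihilator n (A \<union> B) = annihilator n A \<inter> annihilator n B"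
  by (auto simp: annihilator_def)

lemma annihilator_span: "annihilator n (coord.span U) = annihilator n U"
proof
  show "annihilator n (coord.span U) \<subseteq> annihilator n U"
    by (auto simp: annihilator_def coord.span_base)
  show "annihilator n U \<subseteq> annihilator n (coord.span U)"
  proof
    fix y assume y: "y \<in> annihilator n U"
    then have "coord.span U \<subseteq> {v. dot n y v = 0}"
      by (intro coord.span_minimal subspace_dot_right) (auto simp: annihilator_def)
    then show "y \<in> annihilator n (coord.span U)"
      using y by (auto simp: annihilator_def)
  qed
qed

lemma annihilator_coord_space: "annihilator n (coord_space n) = {0}"
proof -
  have "y = 0" if "y \<in> annihilator n (coord_space n)" for y :: "nat \<Rightarrow> 'a"
  proof (rule ccontr)
    assume "y \<noteq> 0"
    with that obtain v where "v \<in> coord_space n" "dot n y v \<noteq> 0"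
      using annihilator_subset dot_nondegenerate by blast
    then show False using that by (auto simp: annihilator_def)
  qed
  then show ?thesis by auto
qed

lemma subspace_annihilator: "coord.subspace (annihilator n U)"
proof -
  have eq: "annihilator n U = coord_space n \<inter> (\<Inter>v\<in>U. {y. dot n y v = 0})"
    by (auto simp: annihilator_def)
  show ?thesis
    unfolding eq
    by (intro coord.subspace_inter coord.subspace_Int subspace_coord_space subspace_dot_left)
qed

text \<open>One more vector imposes one more linear equation, which shrinks the annihilator by a
  factor \<open>q\<close> or not at all.\<close>

lemma card_annihilator_Un_finite:
  fixes B C :: "(nat \<Rightarrow> 'a::{field,finite}) set"
  assumes "finite C"
  shows "card (annihilator n B) \<le> CARD('a) ^ card C * card (annihilator n (B \<union> C))"
  using assms
proof (induction C rule: finite_induct)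
  case (insert c C)
  let ?A = "annihilator n (B \<union> C)"
  have eq: "annihilator n (B \<union> insert c C) = {y \<in> ?A. dot n y c = 0}"
    by (auto simp: annihilator_def)
  have "card ?A \<le> CARD('a) * card {y \<in> ?A. dot n y c = 0}"
  proof (cases "\<exists>y\<in>?A. dot n y c \<noteq> 0")
    case True
    then show ?thesis
      using card_subspace_eq_card_kernel[OF subspace_annihilator, of "\<lambda>y. dot n y c"]
      by (auto simp: dot_add_left dot_cscale_left)
  next
    case False
    then have "{y \<in> ?A. dot n y c = 0} = ?A" by auto
    then show ?thesis by simp
  qed
  then have "CARD('a) ^ card C * card ?A
    \<le> CARD('a) ^ card C * (CARD('a) * card {y \<in> ?A. dot n y c = 0})"
    by (rule mult_left_mono) simp
  with insert.IH have "card (annihilator n B)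
    \<le> CARD('a) ^ card C * (CARD('a) * card {y \<in> ?A. dot n y c = 0})"
    by (rule order_trans)
  with insert show ?case unfolding eq by (simp add: mult_ac)
qed simp

text \<open>
  Each basis vector lowers the annihilator by a factor of at most \<open>q\<close>, and \<open>n\<close> of them take it from
  \<open>q^n\<close> elements down to one, so each factor is exactly \<open>q\<close>.
\<close>

lemma card_annihilator:
  fixes U :: "(nat \<Rightarrow> 'a::{field,finite}) set"
  assumes U: "coord.subspace U" "U \<subseteq> coord_space n"
  shows "card U * card (annihilator n U) = CARD('a) ^ n"
proof -
  let ?V = "coord_space n :: (nat \<Rightarrow> 'a) set"
  obtain B where B: "B \<subseteq> U" "coord.independent B" "U \<subseteq> coord.span B" "card B = coord.dim U"
    using coord.basis_exists by blast
  obtain C where C: "B \<subseteq> C" "C \<subseteq> ?V" "coord.independent C" "?V \<subseteq> coord.span C"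
    using coord.maximal_independent_subset_extend[of B ?V] B U by blast
  have fin: "finite C" "finite B" "finite U"
    using B C U finite_coord_space[where 'a='a] by (meson finite_subset subset_trans)+
  have spanB: "coord.span B = U" using B U coord.span_subspace by blast
  have spanC: "coord.span C = ?V" using C subspace_coord_space coord.span_subspace by blast
  have cardC: "card C = n" using coord.basis_card_eq_dim[OF C(2,4,3)] by (simp add: dim_coord_space)
  have cardU: "card U = CARD('a) ^ card B"
    using card_subspace[OF U(1) fin(3)] B by simp
  have lower: "CARD('a) ^ n \<le> CARD('a) ^ card B * card (annihilator n U)"
    using card_annihilator_Un_finite[OF fin(2), of n "{}"] annihilator_span[of n B]
    by (simp add: spanB card_coord_space)
  have BC: "B \<union> (C - B) = C" and card_diff: "card (C - B) = n - card B"
    using C fin cardC by (auto simp: card_Diff_subset)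
  have "card B \<le> n" using C fin cardC card_mono by blast
  have "card (annihilator n U) \<le> CARD('a) ^ (n - card B)"
    using card_annihilator_Un_finite[of "C - B" n B] annihilator_span[of n B]
      annihilator_span[of n C] fin
    unfolding spanB spanC BC card_diff annihilator_coord_space by (metis (no_types, lifting)
      card.empty card.insert empty_iff finite.emptyI finite_Diff mult.right_neutral One_nat_def)
  then have "CARD('a) ^ card B * card (annihilator n U) \<le> CARD('a) ^ card B * CARD('a) ^ (n - card B)"
    by (rule mult_left_mono) simp
  also have "\<dots> = CARD('a) ^ n" using \<open>card B \<le> n\<close> by (simp flip: power_add)
  finally show ?thesis using lower cardU by simp
qed

lemma card_subspace_sum:
  fixes U U' :: "(nat \<Rightarrow> 'a::{field,finite}) set"
  assumes "coord.subspace U" "coord.subspace U'" "U \<inter> U' = {0}"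
  shows "card (coord.span (U \<union> U')) = card U * card U'"
proof -
  have span: "coord.span (U \<union> U') = (\<lambda>(x, y). x + y) ` (U \<times> U')"
    using assms by (force simp: coord.span_Un image_iff coord.span_eq_iff[THEN iffD2])
  have "inj_on (\<lambda>(x, y). x + y) (U \<times> U')"
  proof (rule inj_onI, clarify)
    fix x y x' y' assume m: "x \<in> U" "x' \<in> U" "y \<in> U'" "y' \<in> U'" and eq: "x + y = x' + y'"
    have "x - x' = y' - y" using eq by (simp add: algebra_simps)
    then have "x - x' \<in> U \<inter> U'" using m assms coord.subspace_diff by (metis IntI)
    then show "x = x' \<and> y = y'" using assms(3) eq by simp
  qed
  then show ?thesis by (simp add: span card_image card_cartesian_product)
qed

subsection \<open>Upper bound for the size of a minimal partition\<close>

text \<open>Multiplication by a nonzero \<open>x\<close> permutes the nonzero elements; comparing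
  products gives \<open>x ^ (CARD('a) - 1) = 1\<close>.\<close>

lemma field_power_card:
  fixes x :: "'a::{field,finite}"
  shows "x ^ CARD('a) = x"
proof (cases "x = 0")
  case False
  have "(\<Prod>y\<in>UNIV-{0}. x * y) = (\<Prod>y\<in>UNIV-{0}. y)"
    by (rule prod.reindex_bij_witness[of _ "\<lambda>y. y / x" "\<lambda>y. x * y"]) (use False in auto)
  then have "x ^ (CARD('a) - 1) = 1" by (simp add: prod.distrib)
  then have "x * x ^ (CARD('a) - 1) = x" by simp
  then show ?thesis by (metis One_nat_def Suc_pred power_Suc zero_less_card_finite)
qed simp

text \<open>
  The polynomial \<open>(X + 1)^q - X^q - 1\<close> has degree less than \<open>q\<close> and vanishes on all of \<open>'a\<close>. This gives
  the additivity of \<open>x \<mapsto> x^q\<close> without knowing that \<open>q\<close> is a power of the characteristic.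
\<close>

lemma of_nat_card_choose_eq_0:
  assumes "0 < i" "i < CARD('a::{field,finite})"
  shows "of_nat (CARD('a) choose i) = (0 :: 'a)"
proof -
  let ?q = "CARD('a)"
  define p where "p = (\<Sum>i\<in>{0<..<?q}. monom (of_nat (?q choose i)) i :: 'a poly)"
  have "poly p x = 0" for x
  proof -
    have "x + 1 = (x + 1) ^ ?q" by (rule field_power_card[symmetric])
    also have "\<dots> = (\<Sum>i\<le>?q. of_nat (?q choose i) * x ^ i)" by (simp add: binomial_ring)
    \<comment> \<open>The end terms are \<open>1\<close> and \<open>x ^ ?q = x\<close>, so the
      middle ones, which form \<open>poly p x\<close>, must vanish.\<close>
    also have "{..?q} = insert 0 (insert ?q {0<..<?q})" by auto
    also have "(\<Sum>i\<in>insert 0 (insert ?q {0<..<?q}). of_nat (?q choose i) * x ^ i)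
        = 1 + (x + poly p x)"
      by (simp add: p_def poly_sum poly_monom field_power_card)
    finally show ?thesis by simp
  qed
  have "p = 0"
  proof (rule ccontr)
    assume "p \<noteq> 0"
    then have "?q \<le> degree p" using card_poly_roots_bound[of p] \<open>\<And>x. poly p x = 0\<close> by simp
    moreover have "degree p \<le> ?q - 1"
      unfolding p_def by (intro degree_sum_le) (auto intro: order_trans[OF degree_monom_le])
    ultimately show False using two_le_card_field[where 'a='a] by simp
  qed
  moreover have "coeff p i = of_nat (?q choose i)"
    using assms by (simp add: p_def coeff_sum)
  ultimately show ?thesis by simp
qed

text \<open>The middle binomial coefficients vanish in \<open>'a\<close>, hence in its closure. This
  makes the roots of \<open>X ^ (q ^ t) - X\<close> closed under addition.\<close>

lemma alg_closure_frobenius_add: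
  fixes x y :: "'a::{field,finite} alg_closure"
  shows "(x + y) ^ (CARD('a) ^ t) = x ^ (CARD('a) ^ t) + y ^ (CARD('a) ^ t)"
proof (induction t)
  case (Suc t)
  let ?q = "CARD('a)"
  have frob: "(u + v) ^ ?q = u ^ ?q + v ^ ?q" for u v :: "'a alg_closure"
  proof -
    have "of_nat (?q choose i) = (0 :: 'a alg_closure)" if "0 < i" "i < ?q" for i
      using of_nat_card_choose_eq_0[OF that] to_ac_of_nat[of "?q choose i", where 'a='a] by simp
    moreover have "{..?q} = insert 0 (insert ?q {0<..<?q})" by auto
    ultimately show ?thesis by (simp add: binomial_ring)
  qed
  show ?case by (simp add: power_mult Suc frob mult.commute[of ?q])
qed simp

text \<open>\<open>X ^ N - X\<close> splits into linear factors and has derivative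
  \<open>-1\<close>, as \<open>N\<close> vanishes in the field. So no root is repeated.\<close>

lemma card_roots_power_eq_self:
  fixes N :: nat
  assumes N: "1 < N" and char: "of_nat N = (0 :: 'b::alg_closed_field)"
  shows "card {x :: 'b. x ^ N = x} = N"
proof -
  define p :: "'b poly" where "p = monom 1 N - monom 1 1"
  have coeffN: "coeff p N = 1" using N by (simp add: p_def)
  have deg: "degree p = N"
  proof (rule antisym)
    show "degree p \<le> N"
      unfolding p_def using N by (intro degree_diff_le) (auto simp: degree_monom_eq)
    show "N \<le> degree p" using coeffN by (intro le_degree) simp
  qed
  then have "p \<noteq> 0" using N by auto
  then obtain M where M: "size M = N" "p = (\<Prod>x\<in>#M. [:-x, 1:])"
    using alg_closed_imp_factorization[of p] deg coeffN by auto
  have "pderiv p = -1"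
    using N char by (simp add: p_def pderiv_diff pderiv_monom one_pCons monom_0)
  have "count M x \<le> 1" for x
  proof (rule ccontr)
    assume "\<not> count M x \<le> 1"
    then have "x \<in># M" "x \<in># M - {#x#}" 
      by (auto simp: in_diff_count simp flip: count_greater_zero_iff)
    then obtain M' where "M = add_mset x (add_mset x M')"
      by (metis insert_DiffM)
    then obtain r where "p = [:-x, 1:] * ([:-x, 1:] * r)" using M by auto
    then have "poly (pderiv p) x = 0" by (simp only: pderiv_mult) simp
    then show False using \<open>pderiv p = -1\<close> by simp
  qed
  then have "count M x = (if x \<in># M then 1 else 0)" for x
    by (metis One_nat_def count_greater_zero_iff le_antisym not_gr0 not_in_iff Suc_leI)
  then have "size M = card (set_mset M)" by (simp add: size_multiset_overloaded_eq)
  moreover have "set_mset M = {x. x ^ N = x}"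
  proof -
    have "poly p x = 0 \<longleftrightarrow> x \<in># M" for x
      unfolding M(2) by (auto simp: poly_prod_mset prod_mset_zero_iff)
    then show ?thesis by (auto simp: p_def poly_monom)
  qed
  ultimately show ?thesis using M by simp
qed

section \<open>The field of order \<open>q ^ t\<close> inside the algebraic closure\<close>

definition ac_scale :: "'a::field \<Rightarrow> 'a alg_closure \<Rightarrow> 'a alg_closure" where
  "ac_scale c x = to_ac c * x"

lemma vector_space_ac_scale: "vector_space ac_scale"
  by unfold_locales (auto simp: ac_scale_def algebra_simps)

text \<open>\<open>K\<close> consists of the fixed points of the \<open>t\<close>-th iterate of
  Frobenius. It is a set and not a type because its order depends on the variable \<open>t\<close>.
  The basis in coordinates lets vectors over \<open>'a\<close> be read as elements of
  \<open>K\<close>.\<close>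

lemma extension_field_basis:
  fixes t :: nat
  assumes "0 < t"
  obtains K :: "'a::{field,finite} alg_closure set" and b :: "nat \<Rightarrow> 'a alg_closure"
  where "card K = CARD('a) ^ t"
    and "\<And>x y. x \<in> K \<Longrightarrow> y \<in> K \<Longrightarrow> x * y \<in> K" "\<And>x y. x \<in> K \<Longrightarrow> y \<in> K \<Longrightarrow> x / y \<in> K"
    and "\<And>x. x \<in> K \<longleftrightarrow> (\<exists>c. x = (\<Sum>i<t. to_ac (c i) * b i))"
    and "\<And>c i. (\<Sum>i<t. to_ac (c i) * b i) = 0 \<Longrightarrow> i < t \<Longrightarrow> c i = 0"
proof -
  interpret ac: vector_space "ac_scale :: 'a \<Rightarrow> _" by (rule vector_space_ac_scale)
  let ?q = "CARD('a)" and ?N = "CARD('a) ^ t"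
  define K where "K = {x :: 'a alg_closure. x ^ ?N = x}"
  have q2: "2 \<le> ?q" by (rule two_le_card_field)
  have "of_nat ?q = (0 :: 'a)"
    using of_nat_card_choose_eq_0[of 1, where 'a='a] q2 by simp
  then have "of_nat ?N = (0 :: 'a)" using assms by (simp add: of_nat_power)
  then have "of_nat ?N = (0 :: 'a alg_closure)"
    by (metis to_ac_0 to_ac_of_nat)
  moreover have "1 < ?N" using q2 assms by (intro one_less_power) auto
  ultimately have card_K: "card K = ?N" unfolding K_def by (intro card_roots_power_eq_self)
  then have "finite K" using q2 by (intro card_ge_0_finite) simp
  have to_ac_K: "to_ac c \<in> K" for c :: 'a
  proof -
    have "c ^ ?N = c" by (induction t) (simp_all add: field_power_card power_mult)
    then show ?thesis by (simp add: K_def flip: to_ac_power)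
  qed
  have sub: "ac.subspace K"
    unfolding ac.subspace_def
    using to_ac_K q2 by (auto simp: K_def alg_closure_frobenius_add ac_scale_def power_mult_distrib)
  obtain B where B: "B \<subseteq> K" "ac.independent B" "K \<subseteq> ac.span B"
    using ac.basis_exists[of K] by metis
  have span: "ac.span B = K" using B sub ac.span_subspace by blast
  have "finite B" using B \<open>finite K\<close> finite_subset by blast
  then have "card B = t"
    using card_span_independent[OF vector_space_ac_scale, of B] B card_K q2 by (simp add: span)
  then obtain b where b: "bij_betw b {..<t} B"
    using ex_bij_betw_nat_finite[OF \<open>finite B\<close>] by (auto simp: atLeast0LessThan)
  have reindex: "(\<Sum>v\<in>B. ac_scale (u v) v) = (\<Sum>i<t. to_ac (u (b i)) * b i)" for u
    unfolding ac_scale_def by (rule sum.reindex_bij_betw[OF b, symmetric])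
  \<comment> \<open>Carries coefficients indexed by \<open>i < t\<close> over to basis vectors, the
    form in which span and independence of \<open>B\<close> are available.\<close>
  define extend where "extend c v = c (the_inv_into {..<t} b v)" for c :: "nat \<Rightarrow> 'a" and v
  have extend: "extend c (b i) = c i" if "i < t" for c i
    using that b by (simp add: extend_def the_inv_into_f_f bij_betw_def)
  have extend_sum: "(\<Sum>i<t. to_ac (c i) * b i) = (\<Sum>v\<in>B. ac_scale (extend c v) v)" for c
    unfolding reindex by (intro sum.cong) (simp_all add: extend)
  show thesis
  proof (rule that[OF card_K])
    show "x * y \<in> K" "x / y \<in> K" if "x \<in> K" "y \<in> K" for x y
      using that by (simp_all add: K_def power_mult_distrib power_divide)
    show "x \<in> K \<longleftrightarrow> (\<exists>c. x = (\<Sum>i<t. to_ac (c i) * b i))" for x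
      unfolding span[symmetric] ac.span_finite[OF \<open>finite B\<close>]
    proof (intro iffI)
      assume "\<exists>c. x = (\<Sum>i<t. to_ac (c i) * b i)"
      then obtain c where "x = (\<Sum>i<t. to_ac (c i) * b i)" by blast
      then have "x = (\<Sum>v\<in>B. ac_scale (extend c v) v)" by (simp only: extend_sum)
      then show "x \<in> range (\<lambda>u. \<Sum>v\<in>B. ac_scale (u v) v)" by blast
    qed (auto simp: reindex)
    show "c i = 0" if "(\<Sum>i<t. to_ac (c i) * b i) = 0" "i < t" for c i
    proof -
      have "b i \<in> B" using b that by (auto simp: bij_betw_def)
      then have "extend c (b i) = 0"
        using ac.independentD[OF B(2) \<open>finite B\<close> subset_refl] that(1) unfolding extend_sum by blast
      then show ?thesis using extend that by simp
    qed
  qed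
qed

text \<open>
  With \<open>r = n - t\<close> the first \<open>r\<close> coordinates of a vector encode an element \<open>\<psi> v\<close> and the last \<open>t\<close>
  coordinates an element \<open>\<phi> v\<close> of the field of order \<open>q^t\<close>; the partition collects the vectors by the
  slope \<open>\<phi> v / \<psi> v\<close>.
\<close>

lemma sigma_le:
  assumes t: "t < n" "n < 2 * t"
  shows "sigma TYPE('a::{field,finite}) n t \<le> CARD('a) ^ t + 1"
proof -
  let ?q = "CARD('a)" and ?V = "coord_space n :: (nat \<Rightarrow> 'a) set"
  define r where "r = n - t"
  have r: "0 < r" "r < t" "n = r + t" using t by (auto simp: r_def)
  have q2: "2 \<le> ?q" by (rule two_le_card_field)
  obtain K :: "'a alg_closure set" and b where
    card_K: "card K = ?q ^ t"
    and mult_K: "\<And>x y. x \<in> K \<Longrightarrow> y \<in> K \<Longrightarrow> x * y \<in> K"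
    and div_K: "\<And>x y. x \<in> K \<Longrightarrow> y \<in> K \<Longrightarrow> x / y \<in> K"
    and K: "\<And>x. x \<in> K \<longleftrightarrow> (\<exists>c. x = (\<Sum>i<t. to_ac (c i) * b i))"
    and indep: "\<And>c i. (\<Sum>i<t. to_ac (c i) * b i) = 0 \<Longrightarrow> i < t \<Longrightarrow> c i = 0"
    using extension_field_basis[of t, where 'a='a] r by blast
  have fin_K: "finite K" using card_K q2 by (intro card_ge_0_finite) simp
  define \<phi> where "\<phi> v = (\<Sum>i<t. to_ac (v (r + i)) * b i)" for v :: "nat \<Rightarrow> 'a"
  \<comment> \<open>The first \<open>r < t\<close> coordinates are padded with zeros so that both
    maps use the same basis.\<close>
  define \<psi> where "\<psi> v = (\<Sum>i<t. to_ac (if i < r then v i else 0) * b i)" for v :: "nat \<Rightarrow> 'a"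
  have \<phi>_K: "\<phi> v \<in> K" and \<psi>_K: "\<psi> v \<in> K" for v
    unfolding \<phi>_def \<psi>_def by (subst K, rule exI, rule refl)+
  have lin: "\<phi> 0 = 0" "\<psi> 0 = 0" "\<phi> (v + w) = \<phi> v + \<phi> w" "\<psi> (v + w) = \<psi> v + \<psi> w"
    "\<phi> (cscale c v) = to_ac c * \<phi> v" "\<psi> (cscale c v) = to_ac c * \<psi> v" for v w c
    by (auto simp: \<phi>_def \<psi>_def cscale_def algebra_simps sum_distrib_left
        simp flip: sum.distrib intro!: sum.cong sum.neutral)
  have v_eq_0: "v = 0" if "v \<in> ?V" "\<phi> v = 0" "\<psi> v = 0" for v
  proof
    fix i
    consider "i < r" | j where "i = r + j" "j < t" | "n \<le> i"
      using r by (metis add_diff_inverse_nat add_less_cancel_left not_less)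
    then show "v i = 0 i"
    proof cases
      case 1
      then show ?thesis using indep[OF that(3)[unfolded \<psi>_def], of i] r by simp
    next
      case 2
      then show ?thesis using indep[OF that(2)[unfolded \<phi>_def], of j] by simp
    next
      case 3
      then show ?thesis using that(1) by (simp add: coord_space_def)
    qed
  qed
  \<comment> \<open>\<open>Z\<close> is the class of infinite slope, \<open>Y a\<close> that of
    slope \<open>a\<close>.\<close>
  define Z where "Z = {v \<in> ?V. \<psi> v = 0}"
  define Y where "Y a = {v \<in> ?V. \<phi> v = a * \<psi> v}" for a
  define P where "P = insert Z (Y ` K)"
  have sub: "coord.subspace Z" "coord.subspace (Y a)" for a
    using subspace_coord_space[of n, where 'a='a]
    by (auto simp: Z_def Y_def coord.subspace_def lin algebra_simps)
  have fin: "finite Z" "finite (Y a)" for a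
    using finite_coord_space[of n, where 'a='a] by (auto simp: Z_def Y_def)
  have "bij_betw \<phi> Z K"
    unfolding bij_betw_def
  proof (intro conjI equalityI subsetI)
    show "inj_on \<phi> Z"
    proof (rule inj_onI)
      fix v w assume v: "v \<in> Z" "w \<in> Z" and eq: "\<phi> v = \<phi> w"
      have "v - w \<in> Z" using v sub coord.subspace_diff by blast
      moreover have "\<phi> (v - w) = 0" using lin(3)[of "v - w" w] eq by simp
      ultimately show "v = w" using v_eq_0[of "v - w"] by (simp add: Z_def)
    qed
    fix x assume "x \<in> K"
    then obtain c where c: "x = (\<Sum>i<t. to_ac (c i) * b i)" using K by blast
    define v where "v i = (if r \<le> i \<and> i < n then c (i - r) else 0)" for i
    have "\<phi> v = x" unfolding \<phi>_def c using r by (intro sum.cong) (simp_all add: v_def)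
    moreover have "v \<in> Z" by (auto simp: Z_def coord_space_def \<psi>_def v_def intro!: sum.neutral)
    ultimately show "x \<in> \<phi> ` Z" by blast
  qed (use \<phi>_K in auto)
  then have card_Z: "card Z = ?q ^ t" using bij_betw_same_card card_K by metis
  then have dim_Z: "coord.dim Z = t"
    using card_subspace[OF sub(1) fin(1)] q2 by simp
  have Z_Int_Y: "Z \<inter> Y a = {0}" for a
    using v_eq_0 by (auto simp: Z_def Y_def lin)
  \<comment> \<open>\<open>Z\<close> and \<open>Y a\<close> form a direct sum inside the whole
    space, so \<open>Y a\<close> has dimension at most \<open>n - t < t\<close>.\<close>
  have dim_Y: "coord.dim (Y a) \<le> t" for a
  proof -
    have "coord.span (Z \<union> Y a) \<subseteq> ?V"
      by (intro coord.span_minimal subspace_coord_space) (auto simp: Z_def Y_def)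
    then have "card Z * card (Y a) \<le> ?q ^ n"
      using card_mono[OF finite_coord_space] card_subspace_sum[OF sub Z_Int_Y]
      by (metis card_coord_space)
    then have "?q ^ (t + coord.dim (Y a)) \<le> ?q ^ n"
      using card_subspace[OF sub(2) fin(2)] card_Z by (simp add: power_add)
    then have "t + coord.dim (Y a) \<le> n" using q2 by (subst (asm) power_increasing_iff) auto
    then show ?thesis using r by linarith
  qed
  have Y_nontrivial: "Y a \<noteq> {0}" if a: "a \<in> K" for a
  proof -
    \<comment> \<open>The unit vector \<open>e\<close> has \<open>\<phi> e = 0\<close> and nonzero
      \<open>\<psi> e\<close>. Since \<open>\<phi>\<close> maps \<open>Z\<close> onto
      \<open>K\<close>, some \<open>v\<close> in \<open>Z\<close> corrects it to slope
      \<open>a\<close>.\<close>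
    define e where "e i = (if i = 0 then 1 else 0 :: 'a)" for i :: nat
    have "a * \<psi> e \<in> K" using a \<psi>_K mult_K by blast
    then obtain v where v: "v \<in> Z" "\<phi> v = a * \<psi> e"
      using \<open>bij_betw \<phi> Z K\<close> by (metis bij_betw_imp_surj_on imageE)
    have e: "e \<in> ?V" using r by (auto simp: e_def coord_space_def)
    have "\<phi> e = 0" using r by (auto simp: \<phi>_def e_def intro!: sum.neutral)
    then have "e + v \<in> Y a"
      using v e coord.subspace_add[OF subspace_coord_space] by (auto simp: Y_def Z_def lin)
    moreover have "e + v \<noteq> 0"
    proof
      assume "e + v = 0"
      then have "\<psi> (e + v) = 0" by (simp add: lin)
      then have "\<psi> e = 0" using v by (simp add: lin Z_def)
      then have "e = 0" using e \<open>\<phi> e = 0\<close> v_eq_0 by blast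
      then show False using fun_cong[of e 0 "0::nat"] e_def by (metis zero_fun_apply zero_neq_one)
    qed
    ultimately show ?thesis by blast
  qed
  have "subspace_partition ?V P"
    unfolding subspace_partition_def
  proof (intro conjI ballI impI)
    fix U assume "U \<in> P"
    then show "coord.subspace U" "U \<subseteq> ?V" using sub by (auto simp: P_def Z_def Y_def)
    have "Z \<noteq> {0}"
    proof
      assume "Z = {0}"
      then have "?q ^ t = 1" using card_Z by simp
      then show False using q2 r by simp
    qed
    then show "U \<noteq> {0}" using Y_nontrivial \<open>U \<in> P\<close> by (auto simp: P_def)
  next
    fix v assume v: "v \<in> ?V" "v \<noteq> 0"
    show "\<exists>!U. U \<in> P \<and> v \<in> U"
    proof (cases "\<psi> v = 0")
      case True
      then have "v \<in> Z" using v by (simp add: Z_def)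
      moreover have "v \<notin> Y a" for a using Z_Int_Y \<open>v \<in> Z\<close> v by blast
      ultimately show ?thesis by (intro ex1I[of _ Z]) (auto simp: P_def)
    next
      case False
      show ?thesis
      proof (rule ex1I[of _ "Y (\<phi> v / \<psi> v)"])
        have "\<phi> v / \<psi> v \<in> K" using div_K \<phi>_K \<psi>_K by blast
        then have "Y (\<phi> v / \<psi> v) \<in> P" by (simp add: P_def)
        moreover have "v \<in> Y (\<phi> v / \<psi> v)" using v False by (simp add: Y_def)
        ultimately show "Y (\<phi> v / \<psi> v) \<in> P \<and> v \<in> Y (\<phi> v / \<psi> v)" ..
        fix U assume U: "U \<in> P \<and> v \<in> U"
        then have "U \<noteq> Z" using False by (auto simp: Z_def)
        then obtain a where "U = Y a" using U by (auto simp: P_def)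
        then have "\<phi> v = a * \<psi> v" using U by (simp add: Y_def)
        then show "U = Y (\<phi> v / \<psi> v)" using False \<open>U = Y a\<close> by simp
      qed
    qed
  qed
  moreover have "Max (coord.dim ` P) = t"
    using fin_K dim_Z dim_Y by (intro Max_eqI) (auto simp: P_def)
  ultimately have "sigma TYPE('a) n t \<le> card P"
    unfolding sigma_def by (intro Least_le) blast
  also have "\<dots> \<le> card (Y ` K) + 1" unfolding P_def using fin_K by (simp add: card_insert_if)
  also have "\<dots> \<le> ?q ^ t + 1" using card_image_le[OF fin_K, of Y] card_K by simp
  finally show ?thesis .
qed

subsection \<open>Moments of the hyperplane weights\<close>

text \<open>A supertail covers only part of the space, so of a partition only the trivial
  intersections are retained.\<close>

definition subspace_packing :: "nat \<Rightarrow> (nat \<Rightarrow> 'a::field) set set \<Rightarrow> bool" where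
  "subspace_packing n A \<longleftrightarrow>
     (\<forall>U\<in>A. coord.subspace U \<and> U \<subseteq> coord_space n) \<and>
     (\<forall>U\<in>A. \<forall>U'\<in>A. U \<noteq> U' \<longrightarrow> U \<inter> U' = {0})"

text \<open>
  The vector \<open>y\<close> stands for the hyperplane orthogonal to it. Admitting \<open>y = 0\<close>, that is the whole space,
  removes the error terms from the moments computed below.
\<close>

definition hyperplane_weight ::
  "nat \<Rightarrow> (nat \<Rightarrow> 'a::field) set set \<Rightarrow> (nat \<Rightarrow> 'a) \<Rightarrow> nat" where
  "hyperplane_weight n A y = (\<Sum>U | U \<in> A \<and> y \<in> annihilator n U. card U)"

lemma finite_subspaces:
  fixes A :: "(nat \<Rightarrow> 'a::{field,finite}) set set"
  assumes "\<And>U. U \<in> A \<Longrightarrow> U \<subseteq> coord_space n"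
  shows "finite A"
proof (rule finite_subset)
  show "A \<subseteq> Pow (coord_space n)" using assms by blast
qed (simp add: finite_coord_space)

lemma finite_packing:
  fixes A :: "(nat \<Rightarrow> 'a::{field,finite}) set set"
  assumes "subspace_packing n A"
  shows "finite A"
  using assms by (intro finite_subspaces[of A n]) (auto simp: subspace_packing_def)

lemma hyperplane_weight_zero: "hyperplane_weight n A 0 = (\<Sum>U\<in>A. card U)"
  by (simp add: hyperplane_weight_def)

text \<open>Distinct members span a direct sum, so \<open>card_annihilator\<close> applies to their
  span. The products avoid division on \<open>nat\<close>, and both cases share one formula so that
  double sums can be evaluated.\<close>

lemma card_annihilator_Int:
  fixes A :: "(nat \<Rightarrow> 'a::{field,finite}) set set"
  assumes A: "subspace_packing n A" and U: "U \<in> A" "U' \<in> A"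
  shows "card U * (card U' * card (annihilator n U \<inter> annihilator n U'))
    = (if U = U' then card U else 1) * CARD('a) ^ n"
proof (cases "U = U'")
  case True
  then show ?thesis
    using card_annihilator[of U n] A U by (simp add: subspace_packing_def)
next
  case False
  have U_sub: "coord.subspace U" "U \<subseteq> coord_space n" "coord.subspace U'" "U' \<subseteq> coord_space n"
      "U \<inter> U' = {0}"
    using A U False unfolding subspace_packing_def by blast+
  have "coord.span (U \<union> U') \<subseteq> coord_space n"
    using U_sub by (intro coord.span_minimal subspace_coord_space) auto
  then have "card (coord.span (U \<union> U')) * card (annihilator n (coord.span (U \<union> U'))) = CARD('a) ^ n"
    by (intro card_annihilator) auto
  then show ?thesis
    using False U_sub by (simp add: annihilator_span annihilator_Un card_subspace_sum mult.assoc)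
qed

text \<open>Double counting of pairs \<open>(y, U)\<close> with \<open>U\<close> orthogonal to
  \<open>y\<close>. The factor \<open>f\<close> is \<open>1\<close> for first moments and the weight
  itself for the second.\<close>

lemma sum_weighted_hyperplane_weight:
  fixes A :: "(nat \<Rightarrow> 'a::{field,finite}) set set"
  assumes "finite A" and "finite Y"
  shows "(\<Sum>y\<in>Y. f y * hyperplane_weight n A y)
    = (\<Sum>U\<in>A. card U * (\<Sum>y\<in>Y \<inter> annihilator n U. f y))"
proof -
  have "(\<Sum>y\<in>Y. f y * hyperplane_weight n A y)
      = (\<Sum>y\<in>Y. \<Sum>U\<in>A. if y \<in> annihilator n U then card U * f y else 0)"
    unfolding hyperplane_weight_def sum_distrib_left using assms
    by (simp add: sum.inter_filter mult.commute)
  also have "\<dots> = (\<Sum>U\<in>A. \<Sum>y\<in>Y. if y \<in> annihilator n U then card U * f y else 0)"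
    by (rule sum.swap)
  also have "\<dots> = (\<Sum>U\<in>A. card U * (\<Sum>y\<in>Y \<inter> annihilator n U. f y))"
    unfolding sum_distrib_left using assms
    by (simp add: sum.inter_restrict)
  finally show ?thesis .
qed

text \<open>Weighting \<open>U\<close> by \<open>card U\<close> cancels its dimension: each member
  contributes \<open>card U * card (annihilator n U) = q ^ n\<close>.\<close>

lemma sum_hyperplane_weight:
  fixes A :: "(nat \<Rightarrow> 'a::{field,finite}) set set"
  assumes A: "subspace_packing n A"
  shows "(\<Sum>y\<in>coord_space n. hyperplane_weight n A y) = card A * CARD('a) ^ n"
proof -
  have "(\<Sum>y\<in>coord_space n. hyperplane_weight n A y)
      = (\<Sum>U\<in>A. card U * card (coord_space n \<inter> annihilator n U))"
    using sum_weighted_hyperplane_weight[OF finite_packing[OF A] finite_coord_space, of "\<lambda>_. 1" n n]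
    by simp
  also have "\<dots> = (\<Sum>U\<in>A. CARD('a) ^ n)"
  proof (rule sum.cong)
    fix U assume "U \<in> A"
    moreover have "coord_space n \<inter> annihilator n U = annihilator n U"
      using annihilator_subset by blast
    ultimately show "card U * card (coord_space n \<inter> annihilator n U) = CARD('a) ^ n"
      using card_annihilator[of U n] A by (simp add: subspace_packing_def)
  qed simp
  finally show ?thesis by simp
qed

lemma sum_hyperplane_weight_annihilator:
  fixes A :: "(nat \<Rightarrow> 'a::{field,finite}) set set"
  assumes A: "subspace_packing n A" and U: "U \<in> A"
  shows "card U * (\<Sum>y\<in>annihilator n U. hyperplane_weight n A y)
    = (card U + (card A - 1)) * CARD('a) ^ n"
proof -
  have "card U * (\<Sum>y\<in>annihilator n U. hyperplane_weight n A y)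
      = (\<Sum>U'\<in>A. card U * (card U' * card (annihilator n U \<inter> annihilator n U')))"
    using sum_weighted_hyperplane_weight[OF finite_packing[OF A] finite_annihilator,
        of "\<lambda>_. 1" n n U]
    by (simp add: sum_distrib_left)
  also have "\<dots> = (\<Sum>U'\<in>A. (if U = U' then card U else 1) * CARD('a) ^ n)"
    using card_annihilator_Int[OF A U] by (intro sum.cong) auto
  also have "\<dots> = (\<Sum>U'\<in>A. if U = U' then card U else 1) * CARD('a) ^ n"
    by (simp add: sum_distrib_right)
  also have "(\<Sum>U'\<in>A. if U = U' then card U else 1) = card U + (card A - 1)"
  proof -
    have "(\<Sum>U'\<in>A - {U}. if U = U' then card U else 1) = (\<Sum>U'\<in>A - {U}. 1)"
      by (intro sum.cong) auto
    then show ?thesis using U finite_packing[OF A] by (subst sum.remove[of _ U]) auto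
  qed
  finally show ?thesis .
qed

text \<open>One factor of the square is expanded over the members, which leaves sums of the weight
  over their annihilators.\<close>

lemma sum_hyperplane_weight_squared:
  fixes A :: "(nat \<Rightarrow> 'a::{field,finite}) set set"
  assumes A: "subspace_packing n A"
  shows "(\<Sum>y\<in>coord_space n. (hyperplane_weight n A y)\<^sup>2)
    = (hyperplane_weight n A 0 + card A * (card A - 1)) * CARD('a) ^ n"
proof -
  have "(\<Sum>y\<in>coord_space n. (hyperplane_weight n A y)\<^sup>2)
      = (\<Sum>U\<in>A. card U * (\<Sum>y\<in>coord_space n \<inter> annihilator n U. hyperplane_weight n A y))"
    unfolding power2_eq_square
    by (rule sum_weighted_hyperplane_weight[OF finite_packing[OF A] finite_coord_space])
  also have "\<dots> = (\<Sum>U\<in>A. (card U + (card A - 1)) * CARD('a) ^ n)"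
  proof (rule sum.cong)
    fix U assume "U \<in> A"
    moreover have "coord_space n \<inter> annihilator n U = annihilator n U"
      using annihilator_subset by blast
    ultimately show "card U * (\<Sum>y\<in>coord_space n \<inter> annihilator n U. hyperplane_weight n A y)
        = (card U + (card A - 1)) * CARD('a) ^ n"
      using sum_hyperplane_weight_annihilator[OF A] by simp
  qed simp
  finally show ?thesis
    by (simp add: hyperplane_weight_zero sum.distrib flip: sum_distrib_right)
qed

text \<open>To be applied with \<open>y\<^sub>0 = 0\<close>, whose weight is the largest and lies
  above the average.\<close>

lemma exists_less_average:
  fixes f :: "'b \<Rightarrow> nat"
  assumes "finite Y" "y\<^sub>0 \<in> Y" "m < f y\<^sub>0" "sum f Y = card Y * m"
  obtains y where "y \<in> Y" "f y < m"
proof -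
  have "\<exists>y\<in>Y. f y < m"
  proof (rule ccontr)
    assume "\<not> (\<exists>y\<in>Y. f y < m)"
    then have "(\<Sum>y\<in>Y. m) < sum f Y"
      using assms by (intro sum_strict_mono_ex1) (auto simp: not_less)
    then show False using assms by simp
  qed
  then show ?thesis using that by blast
qed

text \<open>A nonzero vector lies in at most one member, whereas \<open>0\<close> is counted
  \<open>card A\<close> times. The additive form avoids truncated subtraction.\<close>

lemma card_Union_packing_Int:
  fixes A :: "(nat \<Rightarrow> 'a::{field,finite}) set set"
  assumes A: "subspace_packing n A" and ne: "A \<noteq> {}" and Z: "0 \<in> Z"
  shows "card (\<Union>A \<inter> Z) + card A = (\<Sum>U\<in>A. card (U \<inter> Z)) + 1"
proof -
  have sub: "finite (U \<inter> Z)" "0 \<in> U \<inter> Z" if "U \<in> A" for U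
    using that A Z finite_coord_space[of n, where 'a='a]
    by (auto simp: subspace_packing_def coord.subspace_0 intro: finite_subset)
  have "card (\<Union>U\<in>A. U \<inter> Z - {0}) = (\<Sum>U\<in>A. card (U \<inter> Z - {0}))"
  proof (rule card_UN_disjoint)
    show "\<forall>U\<in>A. \<forall>U'\<in>A. U \<noteq> U' \<longrightarrow> (U \<inter> Z - {0}) \<inter> (U' \<inter> Z - {0}) = {}"
      using A unfolding subspace_packing_def by blast
  qed (use sub finite_packing[OF A] in auto)
  moreover have "(\<Union>U\<in>A. U \<inter> Z - {0}) = \<Union>A \<inter> Z - {0}" by blast
  moreover have "0 \<in> \<Union>A \<inter> Z" using ne sub by blast
  moreover have "finite (\<Union>A \<inter> Z)"
  proof (rule finite_subset[OF _ finite_coord_space])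
    show "\<Union>A \<inter> Z \<subseteq> coord_space n" using A unfolding subspace_packing_def by blast
  qed
  ultimately have "card (\<Union>A \<inter> Z) = Suc (\<Sum>U\<in>A. card (U \<inter> Z - {0}))"
    by (metis card_Suc_Diff1)
  moreover have "(\<Sum>U\<in>A. card (U \<inter> Z - {0})) + card A = (\<Sum>U\<in>A. card (U \<inter> Z))"
  proof -
    have "(\<Sum>U\<in>A. card (U \<inter> Z - {0})) + card A = (\<Sum>U\<in>A. card (U \<inter> Z - {0}) + 1)"
      by (simp only: sum.distrib) simp
    also have "\<dots> = (\<Sum>U\<in>A. card (U \<inter> Z))"
      by (intro sum.cong refl) (metis Suc_eq_plus1 card_Suc_Diff1 sub)
    finally show ?thesis .
  qed
  ultimately show ?thesis by simp
qed

lemma card_Union_packing: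
  fixes A :: "(nat \<Rightarrow> 'a::{field,finite}) set set"
  assumes "subspace_packing n A" and "A \<noteq> {}"
  shows "card (\<Union>A) + card A = hyperplane_weight n A 0 + 1"
  using card_Union_packing_Int[OF assms, of UNIV] by (simp add: hyperplane_weight_zero)

text \<open>The congruence is the only trace of the surrounding partition; \<open>d\<close> will be
  the least dimension outside the supertail. The last conclusion makes the union a direct sum of
  \<open>U\<^sub>0\<close> and any other member.\<close>

lemma minimal_packing:
  fixes A :: "(nat \<Rightarrow> 'a::{field,finite}) set set"
  defines "q \<equiv> CARD('a)"
  assumes A: "subspace_packing n A" and nontrivial: "{0} \<notin> A"
    and td: "t < d" "d \<le> n"
    and U0: "U\<^sub>0 \<in> A" "card U\<^sub>0 = q ^ t"
    and card_A: "card A \<le> q ^ t + 1"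
    and "\<forall>y\<in>coord_space n.
      hyperplane_weight n A y mod q ^ d = hyperplane_weight n A 0 mod q ^ d"
  shows "card A = q ^ t + 1" "coord.subspace (\<Union>A)"
    "\<And>U. U \<in> A \<Longrightarrow> U \<noteq> U\<^sub>0 \<Longrightarrow> card U * q ^ t = card (\<Union>A)"
proof -
  let ?V = "coord_space n :: (nat \<Rightarrow> 'a) set"
  let ?S = "hyperplane_weight n A"
  let ?T = "?S 0"
  have congruent: "?S y mod q ^ d = ?T mod q ^ d" if "y \<in> ?V" for y
    using assms that by blast
  note finA = finite_packing[OF A]
  have q2: "2 \<le> q" unfolding q_def by (rule two_le_card_field)
  then have qpos: "0 < q" by simp
  have sub: "coord.subspace U" "U \<subseteq> ?V" "finite U" if "U \<in> A" for U
    using that A finite_coord_space[of n, where 'a='a]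
    by (auto simp: subspace_packing_def intro: finite_subset)
  have card_U: "2 \<le> card U" if U: "U \<in> A" for U
  proof (rule ccontr)
    assume "\<not> 2 \<le> card U"
    moreover have "0 \<in> U" using sub[OF U] coord.subspace_0 by blast
    ultimately have "U = {0}" using sub(3)[OF U]
      by (metis One_nat_def card_1_singletonE card_gt_0_iff empty_iff less_2_cases not_less
          not_less_zero singletonD)
    then show False using U nontrivial by simp
  qed
  have qd: "2 * q ^ t \<le> q ^ d"
  proof -
    have "2 * q ^ t \<le> q * q ^ t" using q2 by simp
    also have "\<dots> = q ^ Suc t" by simp
    also have "\<dots> \<le> q ^ d" using td qpos by (intro power_increasing) auto
    finally show ?thesis .
  qed
  have qt_pos: "0 < q ^ t" and qd_pos: "0 < q ^ d" using qpos by auto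
  have card_A_pos: "0 < card A" using U0 finA card_gt_0_iff by blast
  have T_ge: "card U\<^sub>0 + 2 * (card A - 1) \<le> ?T"
  proof -
    have "(\<Sum>U\<in>A - {U\<^sub>0}. 2) \<le> (\<Sum>U\<in>A - {U\<^sub>0}. card U)"
      using card_U by (intro sum_mono) auto
    then show ?thesis
      using U0 finA by (simp add: hyperplane_weight_zero sum.remove[of A U\<^sub>0] card_Diff_subset)
  qed
  \<comment> \<open>Over the vectors orthogonal to \<open>U\<^sub>0\<close> the weight averages
    \<open>q ^ t + (card A - 1) \<le> 2 * q ^ t \<le> q ^ d\<close>. Some \<open>y\<close> lies
    below, so its weight is the residue itself, and it includes
    \<open>card U\<^sub>0\<close>.\<close>
  have c_ge: "q ^ t \<le> ?T mod q ^ d"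
  proof -
    have "\<exists>y\<in>annihilator n U\<^sub>0. ?S y < q ^ d"
    \<comment> \<open>For a single member the weight at \<open>0\<close> only equals the average, so
      \<open>y = 0\<close> is taken directly.\<close>
    proof (cases "card A = 1")
      case True
      then have "A = {U\<^sub>0}" using U0 by (auto simp: card_1_singleton_iff)
      then have "?T = q ^ t" using U0 by (simp add: hyperplane_weight_zero)
      moreover have "q ^ t < q ^ d" using qd qt_pos by linarith
      ultimately show ?thesis by (intro bexI[of _ 0]) auto
    next
      case False
      have "card (annihilator n U\<^sub>0) * q ^ t = q ^ n"
        using card_annihilator[OF sub(1,2)[OF U0(1)]] U0 by (simp add: q_def mult.commute)
      then have "q ^ t * (\<Sum>y\<in>annihilator n U\<^sub>0. ?S y)
          = q ^ t * (card (annihilator n U\<^sub>0) * (q ^ t + (card A - 1)))"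
        using sum_hyperplane_weight_annihilator[OF A U0(1)] U0
        by (simp add: q_def[symmetric] mult_ac)
      then have "(\<Sum>y\<in>annihilator n U\<^sub>0. ?S y)
          = card (annihilator n U\<^sub>0) * (q ^ t + (card A - 1))"
        using qpos by (simp add: mult_cancel1)
      moreover have "q ^ t + (card A - 1) < ?T"
        using T_ge False card_A_pos U0 by linarith
      ultimately obtain y where "y \<in> annihilator n U\<^sub>0" "?S y < q ^ t + (card A - 1)"
        using exists_less_average[of "annihilator n U\<^sub>0" 0] by auto
      then show ?thesis using card_A qd by (intro bexI[of _ y]) auto
    qed
    then obtain y where y: "y \<in> annihilator n U\<^sub>0" "?S y < q ^ d" by blast
    have "card U\<^sub>0 \<le> ?S y"
      unfolding hyperplane_weight_def using U0 y finA
      by (intro member_le_sum[of U\<^sub>0 _ card]) auto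
    moreover have "?S y = ?T mod q ^ d"
      using congruent[of y] y annihilator_subset[of n U\<^sub>0] by auto
    ultimately show ?thesis using U0 by simp
  qed
  \<comment> \<open>The average over all \<open>y\<close> is \<open>card A\<close>, so some weight,
    and with it the residue, is less than \<open>card A \<le> q ^ t + 1\<close>. Together with
    \<open>c_ge\<close> this fixes both \<open>card A\<close> and the residue.\<close>
  have "card A < ?T" using T_ge U0 card_A_pos card_U[OF U0(1)] by linarith
  moreover have "sum ?S ?V = card ?V * card A"
    using sum_hyperplane_weight[OF A] by (simp add: card_coord_space)
  ultimately obtain y where y: "y \<in> ?V" "?S y < card A"
    using exists_less_average[of ?V 0 "card A" ?S] finite_coord_space by auto
  have "?T mod q ^ d \<le> ?S y" using congruent[OF y(1)] by (metis mod_less_eq_dividend)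
  with y c_ge card_A show cardA: "card A = q ^ t + 1" by linarith
  with y c_ge \<open>?T mod q ^ d \<le> ?S y\<close> have c: "?T mod q ^ d = q ^ t" by linarith

  define k where "k y = ?S y div q ^ d" for y
  have S_eq: "?S y = q ^ t + k y * q ^ d" if "y \<in> ?V" for y
    using congruent[OF that] c div_mult_mod_eq[of "?S y" "q ^ d"] by (simp add: k_def)
  have T_eq: "?T = q ^ t + k 0 * q ^ d" by (rule S_eq) simp
  have S_le: "?S y \<le> ?T" for y
    unfolding hyperplane_weight_zero unfolding hyperplane_weight_def
    using finA by (intro sum_mono2) auto
  have k_le: "k y \<le> k 0" for y using S_le by (simp add: k_def div_le_mono)
  have sum_k: "q ^ d * (\<Sum>y\<in>?V. k y) = q ^ n"
  proof -
    have "sum ?S ?V = q ^ n * q ^ t + q ^ d * (\<Sum>y\<in>?V. k y)"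
      using S_eq by (simp add: sum.distrib card_coord_space q_def mult.commute
          flip: sum_distrib_right)
    then show ?thesis
      using sum_hyperplane_weight[OF A] cardA by (simp add: q_def[symmetric] algebra_simps)
  qed
  have sum_k2: "(\<Sum>y\<in>?V. (k y)\<^sup>2) = k 0 * (\<Sum>y\<in>?V. k y)"
  proof -
    have "(\<Sum>y\<in>?V. (?S y)\<^sup>2)
        = (\<Sum>y\<in>?V. (q ^ t)\<^sup>2 + 2 * q ^ t * q ^ d * k y + (q ^ d)\<^sup>2 * (k y)\<^sup>2)"
      using S_eq by (intro sum.cong) (simp_all add: power2_eq_square algebra_simps)
    \<comment> \<open>By \<open>sum_k\<close> the mixed term no longer involves \<open>k\<close>. As
      \<open>card A = q ^ t + 1\<close>, all terms cancel against the second moment except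
      \<open>k 0 * q ^ d * q ^ n\<close>.\<close>
    also have "\<dots> = q ^ n * (q ^ t)\<^sup>2 + 2 * q ^ t * q ^ n + (q ^ d)\<^sup>2 * (\<Sum>y\<in>?V. (k y)\<^sup>2)"
      by (simp add: sum.distrib card_coord_space q_def[symmetric] sum_k[symmetric] mult.assoc
          flip: sum_distrib_left)
    also have "(\<Sum>y\<in>?V. (?S y)\<^sup>2) = (q ^ t + k 0 * q ^ d + (q ^ t + 1) * q ^ t) * q ^ n"
      using sum_hyperplane_weight_squared[OF A] cardA T_eq by (simp add: q_def[symmetric])
    finally have "(q ^ d)\<^sup>2 * (\<Sum>y\<in>?V. (k y)\<^sup>2) = k 0 * q ^ d * q ^ n"
      by (simp only: algebra_simps power2_eq_square)
    also have "\<dots> = (q ^ d)\<^sup>2 * (k 0 * (\<Sum>y\<in>?V. k y))"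
      by (simp add: sum_k[symmetric] power2_eq_square mult_ac)
    finally show ?thesis using qpos by simp
  qed
  \<comment> \<open>The second moment is as large as the bound \<open>k y \<le> k 0\<close> permits.\<close>
  have k_cases: "k y = 0 \<or> k y = k 0" if "y \<in> ?V" for y
  proof -
    have "(\<Sum>y\<in>?V. k y * (k 0 - k y)) + (\<Sum>y\<in>?V. (k y)\<^sup>2) = (\<Sum>y\<in>?V. k 0 * k y)"
      unfolding sum.distrib[symmetric]
    proof (rule sum.cong)
      fix y
      have "(k 0 - k y) + k y = k 0" using k_le[of y] by simp
      then show "k y * (k 0 - k y) + (k y)\<^sup>2 = k 0 * k y"
        by (metis distrib_left mult.commute power2_eq_square)
    qed simp
    then have "(\<Sum>y\<in>?V. k y * (k 0 - k y)) = 0"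
      using sum_k2 by (simp add: sum_distrib_left)
    then have "k y * (k 0 - k y) = 0" using that finite_coord_space by (subst (asm) sum_eq_0_iff) auto
    then show ?thesis using k_le[of y] by auto
  qed
  have S_cases: "y \<in> annihilator n (\<Union>A)" if "y \<in> ?V" "?S y \<noteq> q ^ t" for y
  proof -
    have "?S y = ?T" using k_cases[OF that(1)] S_eq[OF that(1)] T_eq that(2) by auto
    \<comment> \<open>Full weight forces every member into the hyperplane, since omitting
      \<open>U\<close> would lose \<open>card U > 0\<close>.\<close>
    have "U \<in> {U \<in> A. y \<in> annihilator n U}" if "U \<in> A" for U
    proof (rule ccontr)
      assume "U \<notin> {U \<in> A. y \<in> annihilator n U}"
      then have "(\<Sum>U | U \<in> A \<and> y \<in> annihilator n U. card U) < (\<Sum>U\<in>A. card U)"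
        using finA that card_U[OF that] by (intro sum_strict_mono2[of A _ U]) auto
      then show False
        using \<open>?S y = ?T\<close> unfolding hyperplane_weight_zero unfolding hyperplane_weight_def by simp
    qed
    then show ?thesis using that by (auto simp: annihilator_Union)
  qed
  let ?W = "coord.span (\<Union>A)"
  have W_sub: "?W \<subseteq> ?V" using sub by (intro coord.span_minimal subspace_coord_space) auto
  have card_W: "card ?W * card (annihilator n (\<Union>A)) = q ^ n"
    using card_annihilator[OF coord.subspace_span W_sub] by (simp add: annihilator_span q_def)
  \<comment> \<open>\<open>k\<close> vanishes off the annihilator of the union and equals
    \<open>k 0\<close> on it, so \<open>sum_k\<close> yields the size of the span.\<close>
  have "(\<Sum>y\<in>?V. k y) = (\<Sum>y\<in>annihilator n (\<Union>A). k y)"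
    using finite_coord_space annihilator_subset[of n "\<Union>A"] S_cases S_eq qd_pos
    by (intro sum.mono_neutral_right) fastforce+
  also have "\<dots> = (\<Sum>y\<in>annihilator n (\<Union>A). k 0)"
  proof (rule sum.cong)
    fix y assume "y \<in> annihilator n (\<Union>A)"
    then have "{U \<in> A. y \<in> annihilator n U} = A" by (auto simp: annihilator_Union)
    then show "k y = k 0" by (simp add: k_def hyperplane_weight_def)
  qed simp
  finally have "card ?W * card (annihilator n (\<Union>A))
      = (k 0 * q ^ d) * card (annihilator n (\<Union>A))"
    using sum_k card_W by (simp add: mult_ac)
  moreover have "0 < card (annihilator n (\<Union>A))"
    using zero_in_annihilator finite_annihilator card_gt_0_iff by blast
  ultimately have card_span: "card ?W = k 0 * q ^ d"
    by (metis mult_right_cancel neq0_conv)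
  have "card (\<Union>A) = k 0 * q ^ d"
    using card_Union_packing[OF A] U0 cardA T_eq by auto
  then have union: "\<Union>A = ?W"
    using card_span coord.span_superset[of "\<Union>A"] finite_subset[OF W_sub finite_coord_space]
    by (intro card_subset_eq) auto
  then show "coord.subspace (\<Union>A)" by (metis coord.subspace_span)
  fix U assume U: "U \<in> A" "U \<noteq> U\<^sub>0"
  \<comment> \<open>Two members in one hyperplane already push its weight above
    \<open>q ^ t\<close>, so it contains all members.\<close>
  have "annihilator n U \<inter> annihilator n U\<^sub>0 = annihilator n (\<Union>A)"
  proof (intro equalityI subsetI)
    fix y assume y: "y \<in> annihilator n U \<inter> annihilator n U\<^sub>0"
    have "(\<Sum>U\<in>{U, U\<^sub>0}. card U) \<le> ?S y"
      unfolding hyperplane_weight_def using finA U U0 y by (intro sum_mono2) auto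
    then have "?S y \<noteq> q ^ t" using U U0 card_U[of U] by auto
    then show "y \<in> annihilator n (\<Union>A)"
      using S_cases y annihilator_subset by blast
  qed (use U U0 in \<open>auto simp: annihilator_Union\<close>)
  then have "card U * q ^ t * card (annihilator n (\<Union>A)) = q ^ n"
    using card_annihilator_Int[OF A U(1) U0(1)] U U0 by (simp add: q_def[symmetric])
  then show "card U * q ^ t = card (\<Union>A)"
    using card_W union \<open>0 < card (annihilator n (\<Union>A))\<close>
    by (metis mult_right_cancel neq0_conv)
qed

subsection \<open>Supertails\<close>

lemma partition_imp_packing:
  assumes "subspace_partition (coord_space n) P"
  shows "subspace_packing n P"
proof -
  have "U \<inter> U' = {0}" if "U \<in> P" "U' \<in> P" "U \<noteq> U'" for U U'
  proof -
    have "0 \<in> U" "0 \<in> U'"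
      using that assms by (auto simp: subspace_partition_def coord.subspace_0)
    moreover have "v = 0" if "v \<in> U" "v \<in> U'" for v
      using assms that \<open>U \<in> P\<close> \<open>U' \<in> P\<close> \<open>U \<noteq> U'\<close> unfolding subspace_partition_def by blast
    ultimately show ?thesis by blast
  qed
  then show ?thesis using assms by (simp add: subspace_packing_def subspace_partition_def)
qed

lemma Union_partition:
  fixes P :: "(nat \<Rightarrow> 'a::field) set set"
  assumes "subspace_partition (coord_space n) P" "P \<noteq> {}"
  shows "\<Union>P = coord_space n"
proof -
  obtain U where "U \<in> P" using assms by blast
  moreover from this have "0 \<in> U"
    using assms by (simp add: subspace_partition_def coord.subspace_0)
  ultimately have "0 \<in> \<Union>P" by blast
  show ?thesis
  proof (intro equalityI subsetI)
    show "v \<in> coord_space n" if "v \<in> \<Union>P" for v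
      using that assms(1) unfolding subspace_partition_def by blast
    fix v :: "nat \<Rightarrow> 'a" assume "v \<in> coord_space n"
    then show "v \<in> \<Union>P"
      using assms(1) \<open>0 \<in> \<Union>P\<close> unfolding subspace_partition_def by (metis UnionI)
  qed
qed

lemma partition_hyperplane_weight_zero:
  fixes P :: "(nat \<Rightarrow> 'a::{field,finite}) set set"
  assumes "subspace_partition (coord_space n) P" "P \<noteq> {}"
  shows "hyperplane_weight n P 0 + 1 = CARD('a) ^ n + card P"
  using card_Union_packing[OF partition_imp_packing[OF assms(1)] assms(2)]
  by (simp add: Union_partition[OF assms] card_coord_space)

text \<open>Members inside the hyperplane keep all their vectors, the others one in
  \<open>q\<close>. Counting the vectors of the hyperplane and of the whole space gives two
  relations that determine the weight.\<close>

lemma partition_hyperplane_weight: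
  fixes P :: "(nat \<Rightarrow> 'a::{field,finite}) set set"
  assumes P: "subspace_partition (coord_space n) P" "P \<noteq> {}"
    and y: "y \<in> coord_space n" "y \<noteq> 0"
  shows "hyperplane_weight n P y + 1 = card P"
proof -
  let ?q = "CARD('a)"
  define Z where "Z = {v. dot n y v = 0}"
  note pack = partition_imp_packing[OF P(1)]
  have [simp]: "finite P" using finite_packing[OF pack] .
  have kernel: "card U = ?q * card (U \<inter> Z)"
    if U: "coord.subspace U" "\<exists>v\<in>U. dot n y v \<noteq> 0" for U
  proof -
    obtain v where v: "v \<in> U" "dot n y v \<noteq> 0" using U by blast
    have "card U = ?q * card {x \<in> U. dot n y x = 0}"
      using U(1) v by (intro card_subspace_eq_card_kernel[where f = "dot n y" and a = v])
        (simp_all add: dot_add_right dot_cscale_right)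
    then show ?thesis by (simp add: Z_def Int_def)
  qed
  have V: "?q ^ n = ?q * card (coord_space n \<inter> Z)"
    using kernel[OF subspace_coord_space] dot_nondegenerate[OF y] card_coord_space by metis
  define a where "a = hyperplane_weight n P y"
  define b where "b = (\<Sum>U | U \<in> P \<and> y \<notin> annihilator n U. card (U \<inter> Z))"
  have split: "(\<Sum>U\<in>P. f U) = (\<Sum>U | U \<in> P \<and> y \<in> annihilator n U. f U)
      + (\<Sum>U | U \<in> P \<and> y \<notin> annihilator n U. f U)" for f :: "_ \<Rightarrow> nat"
    by (subst sum.union_disjoint[symmetric]) (auto intro!: sum.cong)
  have "(\<Sum>U | U \<in> P \<and> y \<in> annihilator n U. card (U \<inter> Z)) = a"
    unfolding a_def hyperplane_weight_def
    by (intro sum.cong refl arg_cong[of _ _ card]) (auto simp: annihilator_def Z_def)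
  then have "(\<Sum>U\<in>P. card (U \<inter> Z)) = a + b" unfolding split b_def by simp
  then have e1: "card (coord_space n \<inter> Z) + card P = a + b + 1"
    using card_Union_packing_Int[OF pack P(2), of Z] Union_partition[OF P] by (simp add: Z_def)
  have "(\<Sum>U | U \<in> P \<and> y \<notin> annihilator n U. card U) = ?q * b"
    unfolding b_def sum_distrib_left
    using pack y by (intro sum.cong refl kernel) (auto simp: subspace_packing_def annihilator_def)
  then have "hyperplane_weight n P 0 = a + ?q * b"
    unfolding hyperplane_weight_zero unfolding a_def hyperplane_weight_def by (simp only: split)
  then have e2: "a + ?q * b + 1 = ?q * card (coord_space n \<inter> Z) + card P"
    using partition_hyperplane_weight_zero[OF P] V by simp
  \<comment> \<open>\<open>q\<close> times the first count, compared with the second, eliminates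
    \<open>b\<close> and the size of the hyperplane; integers permit the subtraction.\<close>
  have "int ?q * (int (card (coord_space n \<inter> Z)) + int (card P)) = int ?q * (int a + int b + 1)"
    using e1 by (metis of_nat_1 of_nat_add)
  moreover have "int a + int ?q * int b + 1 = int ?q * int (card (coord_space n \<inter> Z)) + int (card P)"
    using e2 by (metis of_nat_1 of_nat_add of_nat_mult)
  ultimately have "(int ?q - 1) * (int a + 1) = (int ?q - 1) * int (card P)"
    by (simp add: algebra_simps)
  moreover have "int ?q - 1 \<noteq> 0" using two_le_card_field[where 'a='a] by simp
  ultimately have "int a + 1 = int (card P)" by (simp only: mult_cancel_left) simp
  then show ?thesis unfolding a_def by linarith
qed

text \<open>Members of dimension at least \<open>d\<close> contribute multiples of
  \<open>q ^ d\<close>. The weight of all of \<open>P\<close> is \<open>card P - 1\<close> for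
  nonzero \<open>y\<close> and larger by \<open>q ^ n\<close>, again a multiple of
  \<open>q ^ d\<close>, for \<open>y = 0\<close>.\<close>

lemma supertail_hyperplane_weight_mod:
  fixes P :: "(nat \<Rightarrow> 'a::{field,finite}) set set"
  assumes P: "subspace_partition (coord_space n) P" "P \<noteq> {}"
    and d: "d \<le> n" and y: "y \<in> coord_space n"
  shows "(hyperplane_weight n (supertail P d) y + 1) mod CARD('a) ^ d = card P mod CARD('a) ^ d"
proof -
  let ?q = "CARD('a)"
  note pack = partition_imp_packing[OF P(1)]
  have [simp]: "finite P" using finite_packing[OF pack] .
  let ?R = "{U \<in> P. d \<le> coord.dim U \<and> y \<in> annihilator n U}"
  have "hyperplane_weight n P y = hyperplane_weight n (supertail P d) y + (\<Sum>U\<in>?R. card U)"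
    unfolding hyperplane_weight_def supertail_def
    by (subst sum.union_disjoint[symmetric]) (auto intro!: sum.cong)
  moreover have "?q ^ d dvd (\<Sum>U\<in>?R. card U)"
  proof (rule dvd_sum)
    fix U assume U: "U \<in> ?R"
    then have "coord.subspace U" "finite U"
      using pack finite_coord_space[of n, where 'a='a]
      by (auto simp: subspace_packing_def intro: finite_subset)
    then show "?q ^ d dvd card U" using U card_subspace[of U] by (simp add: le_imp_power_dvd)
  qed
  moreover have "(hyperplane_weight n P y + 1) mod ?q ^ d = card P mod ?q ^ d"
  proof (cases "y = 0")
    case True
    have "?q ^ d dvd ?q ^ n" using d by (rule le_imp_power_dvd)
    then show ?thesis
      using True partition_hyperplane_weight_zero[OF P] by (auto elim!: dvdE)
  next
    case False
    then show ?thesis using partition_hyperplane_weight[OF P y] by simp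
  qed
  ultimately show ?thesis by (auto elim!: dvdE simp: add.commute add.left_commute)
qed

theorem theorem4:
  fixes P :: "(nat \<Rightarrow> 'a::{field,finite}) set set"
    and n q m s :: nat
    and d N :: "nat \<Rightarrow> nat"
    and ST :: "(nat \<Rightarrow> 'a) set set"
    and W :: "(nat \<Rightarrow> 'a) set"
  assumes q: "q = CARD('a)"
    and partition: "subspace_partition (coord_space n) P"
    and type: "has_type P m d N"
    and s: "2 \<le> s" "s \<le> m"
    and ST: "ST = supertail P (d s)"
    and card_ST: "card ST = sigma TYPE('a) (d s) (d (s - 1))"
    and less: "d s < 2 * d (s - 1)"
    and cases: "s - 1 \<le> 2 \<or>
                d s = 2 * d (s - 1) - 1 \<or>
                (\<forall>U\<in>P - ST. \<forall>U'\<in>P - ST. coord.dim U = coord.dim U')"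
    and W: "W = \<Union>ST"
  shows "coord.subspace W \<and> W \<subseteq> coord_space n \<and>
         ((s - 1 = 1 \<and> N (d 1) = q ^ d 1 + 1 \<and> coord.dim W = 2 * d 1) \<or>
          (s - 1 = 2 \<and> N (d 1) = q ^ d 2 \<and> N (d 2) = 1 \<and> coord.dim W = d 1 + d 2))"
proof -
  define t where "t = d (s - 1)"
  have mono: "d i < d j" if "1 \<le> i" "i < j" "j \<le> m" for i j
    using type that unfolding has_type_def strict_mono_on_def by simp
  have dims: "coord.dim ` P = d ` {1..m}" using type by (simp add: has_type_def)
  have N: "N (d i) = card {U \<in> P. coord.dim U = d i}" if "1 \<le> i" "i \<le> m" for i
    using type that by (simp add: has_type_def)
  have dim_ex: "\<exists>U\<in>P. coord.dim U = d i" if "1 \<le> i" "i \<le> m" for i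
    using dims that by (metis atLeastAtMost_iff image_iff)
  have q2: "2 \<le> q" unfolding q by (rule two_le_card_field)
  have td: "t < d s" unfolding t_def using s by (intro mono) auto
  note packP = partition_imp_packing[OF partition]
  have P: "coord.subspace U" "U \<subseteq> coord_space n" "finite U" "card U = q ^ coord.dim U"
    if "U \<in> P" for U
  proof -
    show *: "coord.subspace U" "U \<subseteq> coord_space n" "finite U"
      using that packP finite_coord_space[of n, where 'a='a]
      by (auto simp: subspace_packing_def intro: finite_subset)
    show "card U = q ^ coord.dim U" using card_subspace[OF *(1,3)] q by simp
  qed
  have P_ne: "P \<noteq> {}" using dim_ex s by fastforce
  have ds_le: "d s \<le> n"
  proof -
    obtain U where U: "U \<in> P" "coord.dim U = d s" using dim_ex[of s] s by auto
    then have "q ^ d s \<le> q ^ n"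
      using card_mono[OF finite_coord_space P(2)[OF U(1)]] P(4)[OF U(1)]
      by (simp add: card_coord_space q)
    then show ?thesis using q2 by (subst (asm) power_increasing_iff) auto
  qed
  have ST_sub: "ST \<subseteq> P" by (auto simp: ST supertail_def)
  have pack: "subspace_packing n ST"
    using packP ST_sub unfolding subspace_packing_def by blast
  have dim_ST: "coord.dim ` ST = d ` {1..s - 1}"
  proof (intro equalityI subsetI)
    fix k assume "k \<in> coord.dim ` ST"
    then obtain U where U: "U \<in> P" "coord.dim U = k" "k < d s" by (auto simp: ST supertail_def)
    then obtain i where i: "1 \<le> i" "i \<le> m" "k = d i" using dims by (metis atLeastAtMost_iff image_iff)
    have "i < s"
    proof (rule ccontr)
      assume "\<not> i < s"
      then have "d s \<le> d i" using mono[of s i] s i by (cases "i = s") auto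
      then show False using U i by simp
    qed
    then show "k \<in> d ` {1..s - 1}" using i by auto
  next
    fix k assume "k \<in> d ` {1..s - 1}"
    then obtain i where i: "1 \<le> i" "i < s" "k = d i" using s by auto
    obtain U where "U \<in> P" "coord.dim U = d i" using dim_ex[of i] i s by auto
    then show "k \<in> coord.dim ` ST" using mono[of i s] i s by (force simp: ST supertail_def)
  qed
  have "t \<in> coord.dim ` ST" unfolding dim_ST t_def using s by auto
  then obtain U0 where U0: "U0 \<in> ST" "coord.dim U0 = t" by blast
  \<comment> \<open>Here the size assumption on \<open>ST\<close> and
    \<open>d s < 2 * d (s - 1)\<close> enter, through the partition by slopes.\<close>
  have card_le: "card ST \<le> CARD('a) ^ t + 1"
    unfolding card_ST using sigma_le[of t "d s", where 'a='a] td less by (simp add: t_def)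
  have nontrivial: "{0} \<notin> ST" using partition ST_sub by (auto simp: subspace_partition_def)
  have congr: "\<forall>y\<in>coord_space n. hyperplane_weight n ST y mod CARD('a) ^ d s
      = hyperplane_weight n ST 0 mod CARD('a) ^ d s"
  proof
    fix y :: "nat \<Rightarrow> 'a" assume "y \<in> coord_space n"
    then have "(hyperplane_weight n ST y + 1) mod CARD('a) ^ d s
        = (hyperplane_weight n ST 0 + 1) mod CARD('a) ^ d s"
      using supertail_hyperplane_weight_mod[OF partition P_ne ds_le]
        supertail_hyperplane_weight_mod[OF partition P_ne ds_le zero_in_coord_space]
      unfolding ST by simp
    then show "hyperplane_weight n ST y mod CARD('a) ^ d s
        = hyperplane_weight n ST 0 mod CARD('a) ^ d s"
      by (simp add: nat_mod_eq_iff)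
  qed
  have card_U0: "card U0 = CARD('a) ^ t" using P(4)[of U0] U0 ST_sub q by auto
  note min = minimal_packing[OF pack nontrivial td ds_le U0(1) card_U0 card_le congr]
  have subW: "coord.subspace W" using min(2) W by simp
  have W_V: "W \<subseteq> coord_space n" unfolding W using ST_sub P(2) by blast
  have card_W: "card W = q ^ coord.dim W"
    using card_subspace[OF subW] W_V finite_coord_space finite_subset q by blast
  \<comment> \<open>Every member other than \<open>U0\<close> is a complement of \<open>U0\<close>
    in \<open>W\<close>, so all of these share one dimension.\<close>
  have dimW: "coord.dim W = coord.dim U + t" if U: "U \<in> ST" "U \<noteq> U0" for U
  proof -
    have "q ^ (coord.dim U + t) = q ^ coord.dim W"
      using min(3)[OF U] P(4)[of U] ST_sub U card_W W q by (auto simp: power_add)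
    then show ?thesis using q2 by simp
  qed
  have finST: "finite ST" using finite_packing[OF pack] .
  have cardST: "card ST = q ^ t + 1" using min(1) q by simp
  have "\<not> ST \<subseteq> {U0}"
  proof
    assume "ST \<subseteq> {U0}"
    then have "card ST \<le> 1" using card_mono[of "{U0}" ST] by simp
    then show False using cardST q2 by simp
  qed
  then obtain U1 where U1: "U1 \<in> ST" "U1 \<noteq> U0" by blast
  define r where "r = coord.dim U1"
  have dims_other: "coord.dim U = r" if "U \<in> ST" "U \<noteq> U0" for U
    using dimW[OF that] dimW[OF U1] by (simp add: r_def)
  have dim_W: "coord.dim W = r + t" using dimW[OF U1] by (simp add: r_def)
  \<comment> \<open>Only \<open>r\<close> and \<open>t\<close> occur as dimensions, which leaves
    \<open>1\<close> and \<open>2\<close> as values of \<open>s - 1\<close>.\<close>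
  have two_dims: "d ` {1..s - 1} = {r, t}"
  proof -
    have "coord.dim ` ST \<subseteq> {r, t}" using dims_other U0(2) by blast
    moreover have "r \<in> coord.dim ` ST" unfolding r_def using U1(1) by (rule imageI)
    ultimately show ?thesis using \<open>t \<in> coord.dim ` ST\<close> unfolding dim_ST by blast
  qed
  have N_ST: "N (d i) = card {U \<in> ST. coord.dim U = d i}" if "1 \<le> i" "i < s" for i
  proof -
    have "d i < d s" using mono that s by simp
    then have "{U \<in> P. coord.dim U = d i} = {U \<in> ST. coord.dim U = d i}"
      by (auto simp: ST supertail_def)
    then show ?thesis using N[of i] that s by simp
  qed
  have inj: "inj_on d {1..s - 1}"
  proof (rule inj_onI)
    fix i j assume "i \<in> {1..s - 1}" "j \<in> {1..s - 1}" "d i = d j"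
    moreover from this have "i \<le> m" "j \<le> m" using s by auto
    ultimately show "i = j"
      using mono[of i j] mono[of j i] by (cases i j rule: linorder_cases) auto
  qed
  then have card_dims: "card {r, t} = s - 1"
    using card_image[OF inj] two_dims by simp
  show ?thesis
  proof (cases "r = t")
    case True
    then have s1: "s - 1 = 1" using card_dims by simp
    have "{U \<in> ST. coord.dim U = t} = ST" using dims_other U0 True by auto
    then have "N (d 1) = q ^ d 1 + 1" using N_ST[of 1] s1 s cardST by (simp add: t_def)
    then show ?thesis using subW W_V s1 dim_W True by (simp add: t_def)
  next
    case False
    then have s2: "s - 1 = 2" using card_dims by simp
    then have t: "t = d 2" by (simp add: t_def)
    have "d 1 \<in> {r, t}" unfolding two_dims[symmetric] using s2 by simp
    moreover have "d 1 < d 2" using s s2 by (intro mono) auto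
    ultimately have r: "r = d 1" using t by auto
    \<comment> \<open>\<open>U0\<close> is the only member of dimension \<open>t\<close>; the other
      \<open>q ^ t\<close> members have dimension \<open>r\<close>.\<close>
    have "{U \<in> ST. coord.dim U = r} = ST - {U0}" using dims_other U0 False by auto
    then have "N (d 1) = q ^ d 2" using N_ST[of 1] s2 s cardST r t U0 finST by simp
    moreover have "{U \<in> ST. coord.dim U = t} = {U0}" using dims_other U0 False by auto
    then have "N (d 2) = 1" using N_ST[of 2] s2 s t by simp
    ultimately show ?thesis using subW W_V s2 dim_W r t by simp
  qed
qed

end
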